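(* Let $(K,\tau)$ be a compact abelian group and let $\psi:(K,\tau)\to(K,\tau)$ be a continuous endomorphism. Let $c(K)$ be the connected component of $K$, let $\tau_q$ be the quotient topology induced by $\tau$ on $K/c(K)$, and let $\overline\psi:(K/c(K),\tau_q)\to(K/c(K),\tau_q)$ be the continuous endomorphism induced by $\psi$. Then $$\mathrm{ent}^\star_\tau(\psi)=\mathrm{ent}^\star_{\tau_q}(\overline\psi)=h_{top}(\overline\psi).$$ In particular, if $(K,\tau)$ is totally disconnected, then $\mathrm{ent}^\star_\tau(\psi)=h_{top}(\psi)$.
   Context: Compact groups are Hausdorff; $c(K)$ is the connected component of $0$ in $K$. For an abelian group $G$, let $\mathcal C(G)$ be the family of all finite-index subgroups of $G$. For an endomorphism $\phi$ of $G$, $N\in\mathcal C(G)$ and an integer $n\ge 1$, let $B_n(\phi,N)=N\cap\phi^{-1}(N)\cap\ldots\cap\phi^{-n+1}(N)$, $C_n(\phi,N)=G/B_n(\phi,N)$ (a finite group), and $H^\star(\phi,N)=\lim_{n\to\infty}\frac{\log|C_n(\phi,N)|}{n}$ (the limit exists and is finite). For a topological abelian group $(G,\tau)$ let $\mathcal C_\tau(G)=\{N\in\mathcal C(G): N \text{ is } \tau\text{-open}\}$. The topological adjoint entropy of a continuous endomorphism $\phi:(G,\tau)\to(G,\tau)$ is $\mathrm{ent}^\star_\tau(\phi)=\sup\{H^\star(\phi,N):N\in\mathcal C_\tau(G)\}\in[0,\infty]$. Topological entropy (Adler–Konheim–McAndrew): for a compact space $X$ and an open cover $\mathcal U$ of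 $X$, $N(\mathcal U)$ is the minimal cardinality of a subcover of $\mathcal U$ and $H(\mathcal U)=\log N(\mathcal U)$. For open covers, $\mathcal U\vee\mathcal V=\{U\cap V:U\in\mathcal U,V\in\mathcal V\}$, and for continuous $\psi:X\to X$, $\psi^{-1}(\mathcal U)=\{\psi^{-1}(U):U\in\mathcal U\}$. Put $H_{top}(\psi,\mathcal U)=\lim_{n\to\infty}\frac{H(\mathcal U\vee\psi^{-1}(\mathcal U)\vee\ldots\vee\psi^{-n+1}(\mathcal U))}{n}$ and $h_{top}(\psi)=\sup\{H_{top}(\psi,\mathcal U):\mathcal U\text{ an open cover of }X\}$. *)

theory Defs
  imports "HOL-Algebra.Coset" "HOL-Analysis.Analysis"
begin

section \<open>Topological abelian groups\<close>

locale topological_abelian_group = comm_group G for G (structure) +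
  fixes T :: "'a topology"
  assumes topspace_eq_carrier: "topspace T = carrier G"
    and continuous_mult: "continuous_map (prod_topology T T) T (\<lambda>(x, y). x \<otimes> y)"
    and continuous_inv: "continuous_map T T (\<lambda>x. inv x)"

locale compact_abelian_group = topological_abelian_group +
  assumes compact: "compact_space T"
    and Hausdorff: "Hausdorff_space T"

definition identity_component :: "('a, 'b) monoid_scheme \<Rightarrow> 'a topology \<Rightarrow> 'a set" where
  "identity_component G T = connected_component_of_set T \<one>\<^bsub>G\<^esub>"

definition totally_disconnected_space :: "'a topology \<Rightarrow> bool" where
  "totally_disconnected_space X \<longleftrightarrow>
     (\<forall>x \<in> topspace X. connected_component_of_set X x = {x})"

definition quotient_group_topology ::
    "('a, 'b) monoid_scheme \<Rightarrow> 'a topology \<Rightarrow> 'a set \<Rightarrow> 'a set topology" where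
  "quotient_group_topology G T H =
     topology (\<lambda>U. U \<subseteq> carrier (G Mod H) \<and> openin T {x \<in> topspace T. H #>\<^bsub>G\<^esub> x \<in> U})"

text \<open>The value on a coset \<open>C\<close> is the common coset of the images of the elements of \<open>C\<close>;
  see \<open>induced_endo_coset\<close> below for the well-definedness condition.\<close>

definition induced_endo ::
    "('a, 'b) monoid_scheme \<Rightarrow> 'a set \<Rightarrow> ('a \<Rightarrow> 'a) \<Rightarrow> 'a set \<Rightarrow> 'a set" where
  "induced_endo G H \<phi> C = the_elem ((\<lambda>x. H #>\<^bsub>G\<^esub> \<phi> x) ` C)"


section \<open>Topological adjoint entropy\<close>

definition finite_index_subgroups :: "('a, 'b) monoid_scheme \<Rightarrow> 'a set set" where
  "finite_index_subgroups G = {N. subgroup N G \<and> finite (rcosets\<^bsub>G\<^esub> N)}"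

definition open_finite_index_subgroups ::
    "('a, 'b) monoid_scheme \<Rightarrow> 'a topology \<Rightarrow> 'a set set" where
  "open_finite_index_subgroups G T = {N \<in> finite_index_subgroups G. openin T N}"

text \<open>\<open>cotrajectory G \<phi> N n\<close> is \<open>N \<inter> \<phi>\<^sup>-\<^sup>1 N \<inter> \<dots> \<inter> \<phi>\<^sup>-\<^sup>n\<^sup>+\<^sup>1 N\<close> for \<open>n \<ge> 1\<close>, preimages being taken
  inside the carrier. The limits below are of sequences of reals; their term at \<open>n = 0\<close>
  is \<open>0\<close> and plays no role.\<close>

definition cotrajectory ::
    "('a, 'b) monoid_scheme \<Rightarrow> ('a \<Rightarrow> 'a) \<Rightarrow> 'a set \<Rightarrow> nat \<Rightarrow> 'a set" where
  "cotrajectory G \<phi> N n = {x \<in> carrier G. \<forall>i<n. (\<phi> ^^ i) x \<in> N}"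

definition cotrajectory_quotient ::
    "('a, 'b) monoid_scheme \<Rightarrow> ('a \<Rightarrow> 'a) \<Rightarrow> 'a set \<Rightarrow> nat \<Rightarrow> 'a set monoid" where
  "cotrajectory_quotient G \<phi> N n = G Mod cotrajectory G \<phi> N n"

definition adjoint_entropy_wrt ::
    "('a, 'b) monoid_scheme \<Rightarrow> ('a \<Rightarrow> 'a) \<Rightarrow> 'a set \<Rightarrow> real" where
  "adjoint_entropy_wrt G \<phi> N =
     lim (\<lambda>n. ln (real (card (carrier (cotrajectory_quotient G \<phi> N n)))) / real n)"

definition topological_adjoint_entropy ::
    "('a, 'b) monoid_scheme \<Rightarrow> 'a topology \<Rightarrow> ('a \<Rightarrow> 'a) \<Rightarrow> ereal" where
  "topological_adjoint_entropy G T \<phi> =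
     (SUP N \<in> open_finite_index_subgroups G T. ereal (adjoint_entropy_wrt G \<phi> N))"


section \<open>Topological entropy\<close>

definition open_cover :: "'a topology \<Rightarrow> 'a set set \<Rightarrow> bool" where
  "open_cover X \<U> \<longleftrightarrow> (\<forall>U \<in> \<U>. openin X U) \<and> \<Union>\<U> = topspace X"

definition min_subcover_card :: "'a topology \<Rightarrow> 'a set set \<Rightarrow> nat" where
  "min_subcover_card X \<U> =
     (LEAST k. \<exists>\<V>. \<V> \<subseteq> \<U> \<and> finite \<V> \<and> \<Union>\<V> = topspace X \<and> card \<V> = k)"

definition cover_entropy :: "'a topology \<Rightarrow> 'a set set \<Rightarrow> real" where
  "cover_entropy X \<U> = ln (real (min_subcover_card X \<U>))"

definition cover_join :: "'a set set \<Rightarrow> 'a set set \<Rightarrow> 'a set set" where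
  "cover_join \<U> \<V> = {U \<inter> V |U V. U \<in> \<U> \<and> V \<in> \<V>}"

definition cover_preimage :: "'a topology \<Rightarrow> ('a \<Rightarrow> 'a) \<Rightarrow> 'a set set \<Rightarrow> 'a set set" where
  "cover_preimage X \<psi> \<U> = {{x \<in> topspace X. \<psi> x \<in> U} |U. U \<in> \<U>}"

text \<open>The join of the first \<open>n\<close> preimages of \<open>\<U>\<close>. The trivial cover \<open>{topspace X}\<close>, which is
  neutral for joins of open covers, is the empty join.\<close>

primrec iterated_join :: "'a topology \<Rightarrow> ('a \<Rightarrow> 'a) \<Rightarrow> 'a set set \<Rightarrow> nat \<Rightarrow> 'a set set" where
  "iterated_join X \<psi> \<U> 0 = {topspace X}"
| "iterated_join X \<psi> \<U> (Suc n) =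
     cover_join (iterated_join X \<psi> \<U> n) (cover_preimage X (\<psi> ^^ n) \<U>)"

definition topological_entropy_wrt ::
    "'a topology \<Rightarrow> ('a \<Rightarrow> 'a) \<Rightarrow> 'a set set \<Rightarrow> real" where
  "topological_entropy_wrt X \<psi> \<U> =
     lim (\<lambda>n. cover_entropy X (iterated_join X \<psi> \<U> n) / real n)"

definition topological_entropy :: "'a topology \<Rightarrow> ('a \<Rightarrow> 'a) \<Rightarrow> ereal" where
  "topological_entropy X \<psi> =
     (SUP \<U> \<in> {\<U>. open_cover X \<U>}. ereal (topological_entropy_wrt X \<psi> \<U>))"


section \<open>Consistency facts\<close>

lemma iterated_join_1:
  assumes "open_cover X \<U>"
  shows "iterated_join X \<psi> \<U> (Suc 0) = \<U>"
proof -
  have *: "{x \<in> topspace X. x \<in> U} = U" "topspace X \<inter> U = U" if "U \<in> \<U>" for U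
    using assms that openin_subset[of X U] by (auto simp: open_cover_def)
  have "iterated_join X \<psi> \<U> (Suc 0) = (\<lambda>U. topspace X \<inter> {x \<in> topspace X. x \<in> U}) ` \<U>"
    by (auto simp: cover_join_def cover_preimage_def)
  also have "\<dots> = (\<lambda>U. U) ` \<U>"
    by (rule image_cong) (auto simp: *)
  finally show ?thesis by simp
qed

lemma istopology_quotient_group:
  "istopology (\<lambda>U. U \<subseteq> carrier (G Mod H) \<and> openin T {x \<in> topspace T. H #>\<^bsub>G\<^esub> x \<in> U})"
  unfolding istopology_def
proof (intro conjI allI impI)
  fix S S'
  assume S: "S \<subseteq> carrier (G Mod H) \<and> openin T {x \<in> topspace T. H #>\<^bsub>G\<^esub> x \<in> S}"
    and S': "S' \<subseteq> carrier (G Mod H) \<and> openin T {x \<in> topspace T. H #>\<^bsub>G\<^esub> x \<in> S'}"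
  show "S \<inter> S' \<subseteq> carrier (G Mod H)" using S by blast
  have "{x \<in> topspace T. H #>\<^bsub>G\<^esub> x \<in> S \<inter> S'} =
      {x \<in> topspace T. H #>\<^bsub>G\<^esub> x \<in> S} \<inter> {x \<in> topspace T. H #>\<^bsub>G\<^esub> x \<in> S'}" by blast
  then show "openin T {x \<in> topspace T. H #>\<^bsub>G\<^esub> x \<in> S \<inter> S'}"
    using S S' by (simp add: openin_Int)
next
  fix \<K>
  assume K: "\<forall>S\<in>\<K>. S \<subseteq> carrier (G Mod H) \<and> openin T {x \<in> topspace T. H #>\<^bsub>G\<^esub> x \<in> S}"
  then show "\<Union>\<K> \<subseteq> carrier (G Mod H)" by blast
  have "{x \<in> topspace T. H #>\<^bsub>G\<^esub> x \<in> \<Union>\<K>} = (\<Union>S\<in>\<K>. {x \<in> topspace T. H #>\<^bsub>G\<^esub> x \<in> S})" by blast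
  then show "openin T {x \<in> topspace T. H #>\<^bsub>G\<^esub> x \<in> \<Union>\<K>}"
    using K by (simp only:) (rule openin_Union, blast)
qed

lemma openin_quotient_group_topology:
  "openin (quotient_group_topology G T H) U \<longleftrightarrow>
     U \<subseteq> carrier (G Mod H) \<and> openin T {x \<in> topspace T. H #>\<^bsub>G\<^esub> x \<in> U}"
  unfolding quotient_group_topology_def topology_inverse'[OF istopology_quotient_group] ..

context topological_abelian_group
begin

lemma topspace_quotient_group_topology:
  "topspace (quotient_group_topology G T H) = carrier (G Mod H)"
proof
  show "topspace (quotient_group_topology G T H) \<subseteq> carrier (G Mod H)"
    using openin_topspace[of "quotient_group_topology G T H"]
    unfolding openin_quotient_group_topology by (rule conjunct1)
  have "{x \<in> topspace T. H #> x \<in> carrier (G Mod H)} = topspace T"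
    by (auto simp: carrier_FactGroup topspace_eq_carrier)
  then have "openin (quotient_group_topology G T H) (carrier (G Mod H))"
    by (simp add: openin_quotient_group_topology)
  then show "carrier (G Mod H) \<subseteq> topspace (quotient_group_topology G T H)"
    by (rule openin_subset)
qed

lemma quotient_map_cosets: "quotient_map T (quotient_group_topology G T H) (\<lambda>x. H #> x)"
  unfolding quotient_map_def topspace_quotient_group_topology openin_quotient_group_topology
  by (simp add: carrier_FactGroup topspace_eq_carrier)

lemma subgroup_identity_component: "subgroup (identity_component G T) G"
proof
  have one: "\<one> \<in> topspace T" by (simp add: topspace_eq_carrier)
  show sub: "identity_component G T \<subseteq> carrier G"
    unfolding identity_component_def
    by (metis connected_component_of_subset_topspace topspace_eq_carrier)
  show "\<one> \<in> identity_component G T"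
    by (simp add: identity_component_def connected_component_of_refl one)
  fix x assume x: "x \<in> identity_component G T"
  have cx: "connected_component_of T \<one> x" using x by (simp add: identity_component_def)
  have xc: "x \<in> carrier G" using x sub by blast
  from connected_component_of_continuous_image[OF continuous_inv cx]
  show "inv x \<in> identity_component G T" by (simp add: identity_component_def)
  fix y assume y: "y \<in> identity_component G T"
  have cy: "connected_component_of T \<one> y" using y by (simp add: identity_component_def)
  have "continuous_map T T ((\<lambda>(x, y). x \<otimes> y) \<circ> (\<lambda>z. (x, z)))"
    by (rule continuous_map_compose[OF _ continuous_mult])
       (simp add: continuous_map_pairedI topspace_eq_carrier xc)
  then have "connected_component_of T (x \<otimes> \<one>) (x \<otimes> y)"
    using connected_component_of_continuous_image[OF _ cy] by force
  then have "connected_component_of T x (x \<otimes> y)" using xc by simp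
  then show "x \<otimes> y \<in> identity_component G T"
    using connected_component_of_trans[OF cx] by (simp add: identity_component_def)
qed

lemma identity_component_invariant:
  assumes "\<phi> \<in> hom G G" "continuous_map T T \<phi>"
  shows "\<phi> ` identity_component G T \<subseteq> identity_component G T"
proof -
  have "\<phi> \<one> = \<one>" using hom_one[OF assms(1) is_group is_group] .
  then have "connected_component_of T \<one> (\<phi> x)" if "connected_component_of T \<one> x" for x
    using connected_component_of_continuous_image[OF assms(2) that] by simp
  then show ?thesis
    by (simp add: identity_component_def image_subset_iff)
qed

lemma induced_endo_coset:
  assumes \<phi>: "\<phi> \<in> hom G G" and H: "subgroup H G" and inv: "\<phi> ` H \<subseteq> H" and x: "x \<in> carrier G"
  shows "induced_endo G H \<phi> (H #> x) = H #> \<phi> x"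
proof -
  interpret H: subgroup H G by (rule H)
  have px: "\<phi> x \<in> carrier G" using \<phi> x by (auto simp: hom_def)
  have "H #> \<phi> y = H #> \<phi> x" if y: "y \<in> H #> x" for y
  proof -
    obtain h where h: "h \<in> H" "y = h \<otimes> x" using y by (auto simp: r_coset_def)
    then have "\<phi> y = \<phi> h \<otimes> \<phi> x" using \<phi> x H.subset by (auto simp: hom_def)
    then have "\<phi> y \<in> H #> \<phi> x" using h inv by (auto simp: r_coset_def)
    then show ?thesis using repr_independence[OF _ px H] by metis
  qed
  moreover have "x \<in> H #> x" using rcos_self[OF x H] .
  ultimately have "(\<lambda>y. H #> \<phi> y) ` (H #> x) = {H #> \<phi> x}" by blast
  then show ?thesis by (simp add: induced_endo_def)
qed

lemma induced_endo_hom: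
  assumes \<phi>: "\<phi> \<in> hom G G" and H: "subgroup H G" and inv: "\<phi> ` H \<subseteq> H"
  shows "induced_endo G H \<phi> \<in> hom (G Mod H) (G Mod H)"
proof -
  interpret N: normal H G using H normal_iff_subgroup by blast
  have pc: "\<phi> x \<in> carrier G" if "x \<in> carrier G" for x using \<phi> that by (auto simp: hom_def)
  have "induced_endo G H \<phi> ((H #> x) <#> (H #> y)) =
      induced_endo G H \<phi> (H #> x) <#> induced_endo G H \<phi> (H #> y)"
    if "x \<in> carrier G" "y \<in> carrier G" for x y
    using that \<phi> by (simp add: N.rcos_sum induced_endo_coset[OF assms] pc hom_mult)
  then show ?thesis
    by (auto simp: hom_def carrier_FactGroup induced_endo_coset[OF assms] pc)
qed

lemma induced_endo_continuous:
  assumes \<phi>: "\<phi> \<in> hom G G" and H: "subgroup H G" and inv: "\<phi> ` H \<subseteq> H"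
    and cont: "continuous_map T T \<phi>"
  shows "continuous_map (quotient_group_topology G T H) (quotient_group_topology G T H)
           (induced_endo G H \<phi>)"
proof -
  let ?Q = "quotient_group_topology G T H"
  have "continuous_map T ?Q ((\<lambda>x. H #> x) \<circ> \<phi>)"
    using cont quotient_imp_continuous_map[OF quotient_map_cosets] by (rule continuous_map_compose)
  then have "continuous_map T ?Q (induced_endo G H \<phi> \<circ> (\<lambda>x. H #> x))"
    by (rule continuous_map_eq) (simp add: induced_endo_coset[OF \<phi> H inv] topspace_eq_carrier)
  then show ?thesis
    using continuous_compose_quotient_map[OF quotient_map_cosets] by blast
qed

end

end

(*
  In a compact Hausdorff group the component c of the identity is the intersection of the clopen
  sets containing it, and the stabiliser of a clopen set under translation is an open subgroup.
  Hence every open neighbourhood of c contains an open subgroup, and by compactness every open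
  cover of K/c is refined by the cosets of a single open subgroup N. For such a coset cover the
  n-th join is the partition into cosets of B_n(psi, N), so its minimal subcovers have exactly
  |K/B_n| members; since cover entropy is monotone under refinement, the suprema over subgroups
  and over covers agree. Open subgroups of K contain c, so pulling back along K -> K/c matches
  the open subgroups of K/c with those of K, preserving the indices of all cotrajectories.
*)

theory Submission
  imports Defs
begin

section \<open>Fekete's lemma on averages of subadditive sequences\<close>

section \<open>Subadditive sequences\<close>

text \<open>Fekete's lemma: the limit is the infimum \<open>L\<close> of the averages, which is a
  real number because nonnegativity bounds them below.\<close>

lemma subadditive_convergent:
  fixes a :: "nat \<Rightarrow> real"
  assumes sub: "\<And>m n. a (m + n) \<le> a m + a n" and nonneg: "\<And>n. 0 \<le> a n"
  shows "convergent (\<lambda>n. a n / real n)"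
proof -
  define L where "L = Inf ((\<lambda>n. a n / real n) ` {1..})"
  have bdd: "bdd_below ((\<lambda>n. a n / real n) ` {1..})"
    by (rule bdd_belowI[of _ 0]) (auto simp: nonneg)
  have L_le: "L \<le> a n / real n" if "n \<ge> 1" for n
    unfolding L_def by (rule cINF_lower[OF bdd]) (use that in auto)
  \<comment> \<open>Used below with \<open>q = n div m\<close> and \<open>r = n mod m\<close>, to
    compare the average at \<open>n\<close> with that at a fixed \<open>m\<close>.\<close>
  have mult: "a (q * m + r) \<le> real q * a m + a r" for q m r
  proof (induction q)
    case (Suc q)
    have "a (Suc q * m + r) \<le> a m + a (q * m + r)"
      using sub[of m "q * m + r"] by (simp add: add.assoc)
    with Suc show ?case by (simp add: algebra_simps)
  qed simp
  have "(\<lambda>n. a n / real n) \<longlonglongrightarrow> L"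
  proof (rule LIMSEQ_I)
    fix e :: real assume e: "0 < e"
    have "\<exists>z \<in> (\<lambda>n. a n / real n) ` {1..}. z < L + e / 2"
      unfolding L_def by (rule cInf_lessD) (use e in auto)
    then obtain m where m: "m \<ge> 1" "a m / real m < L + e / 2" by auto
    \<comment> \<open>Bounds \<open>a r\<close> for every remainder \<open>r\<close> modulo
      \<open>m\<close>, independently of \<open>n\<close>, so its share \<open>C / n\<close> of the
      average vanishes.\<close>
    define C where "C = (\<Sum>r<m. a r)"
    have bound: "a n / real n \<le> a m / real m + C / real n" if n: "n \<ge> 1" for n
    proof -
      have "a (n mod m) \<le> C"
        unfolding C_def by (rule member_le_sum) (use m nonneg in auto)
      moreover have "real (n div m) * a m \<le> real n / real m * a m"
        by (intro mult_right_mono of_nat_div_le_of_nat nonneg)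
      ultimately have "a n \<le> real n / real m * a m + C"
        using mult[of "n div m" m "n mod m"] by simp
      then have "a n / real n \<le> (real n / real m * a m + C) / real n"
        by (rule divide_right_mono) simp
      also have "\<dots> = a m / real m + C / real n"
        using n by (simp add: field_simps)
      finally show ?thesis .
    qed
    \<comment> \<open>Beyond \<open>n0\<close> the remainder costs less than \<open>e / 2\<close>;
      the choice of \<open>m\<close> has used the other half of \<open>e\<close>.\<close>
    obtain n0 :: nat where n0: "n0 > 2 * C / e" using reals_Archimedean2 by blast
    show "\<exists>no. \<forall>n\<ge>no. norm (a n / real n - L) < e"
    proof (intro exI allI impI)
      fix n assume n: "n \<ge> max 1 n0"
      have "2 * C / e < real n" using n0 n by linarith
      then have "C / real n < e / 2" using e n by (simp add: field_simps)
      then have "a n / real n < L + e" using bound[of n] m(2) n by linarith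
      with L_le[of n] n show "norm (a n / real n - L) < e" by simp
    qed
  qed
  then show ?thesis by (rule convergentI)
qed

section \<open>Minimal subcovers under refinement, joins and preimages\<close>

section \<open>Open covers\<close>

text \<open>Compactness supplies a finite subcover, so the \<open>LEAST\<close> in the definition
  ranges over a nonempty set and is realised.\<close>

lemma min_subcover_card_attained:
  assumes "compact_space X" "open_cover X \<U>"
  obtains \<V> where "\<V> \<subseteq> \<U>" "finite \<V>" "\<Union>\<V> = topspace X" "card \<V> = min_subcover_card X \<U>"
proof -
  have "\<exists>k \<V>. \<V> \<subseteq> \<U> \<and> finite \<V> \<and> \<Union>\<V> = topspace X \<and> card \<V> = k"
    using assms unfolding compact_space open_cover_def by metis
  from LeastI_ex[OF this] that show thesis unfolding min_subcover_card_def by blast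
qed

lemma min_subcover_card_le:
  assumes "\<V> \<subseteq> \<U>" "finite \<V>" "\<Union>\<V> = topspace X"
  shows "min_subcover_card X \<U> \<le> card \<V>"
  unfolding min_subcover_card_def by (rule Least_le) (use assms in blast)

lemma min_subcover_card_pos:
  assumes "compact_space X" "open_cover X \<U>" "topspace X \<noteq> {}"
  shows "0 < min_subcover_card X \<U>"
proof -
  obtain \<V> where V: "\<V> \<subseteq> \<U>" "finite \<V>" "\<Union>\<V> = topspace X" "card \<V> = min_subcover_card X \<U>"
    by (rule min_subcover_card_attained[OF assms(1,2)])
  then have "\<V> \<noteq> {}" using assms(3) by (metis Union_empty)
  then show ?thesis using V(2,4) card_gt_0_iff[of \<V>] by simp
qed

text \<open>Replacing each member of a minimal subcover of the finer cover by a member of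
  \<open>\<U>\<close> above it gives a subcover of \<open>\<U>\<close> that is no larger.\<close>

lemma min_subcover_card_refine:
  assumes "compact_space X" "open_cover X \<V>" "\<Union>\<U> = topspace X"
    and "\<And>V. V \<in> \<V> \<Longrightarrow> \<exists>U\<in>\<U>. V \<subseteq> U"
  shows "min_subcover_card X \<U> \<le> min_subcover_card X \<V>"
proof -
  obtain \<W> where W: "\<W> \<subseteq> \<V>" "finite \<W>" "\<Union>\<W> = topspace X" "card \<W> = min_subcover_card X \<V>"
    by (rule min_subcover_card_attained[OF assms(1,2)])
  obtain f where f: "\<And>V. V \<in> \<V> \<Longrightarrow> f V \<in> \<U> \<and> V \<subseteq> f V" using assms(4) by metis
  have fW: "f V \<in> \<U>" "V \<subseteq> f V" if "V \<in> \<W>" for V using f W(1) that by auto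
  have "\<Union>(f ` \<W>) = topspace X"
  proof
    show "\<Union>(f ` \<W>) \<subseteq> topspace X" unfolding assms(3)[symmetric] using fW(1) by blast
    show "topspace X \<subseteq> \<Union>(f ` \<W>)" unfolding W(3)[symmetric] using fW(2) by blast
  qed
  then have "min_subcover_card X \<U> \<le> card (f ` \<W>)"
    by (intro min_subcover_card_le) (use f W in auto)
  also have "\<dots> \<le> card \<W>" by (rule card_image_le[OF W(2)])
  finally show ?thesis using W(4) by simp
qed

lemma cover_joinI: "U \<in> \<U> \<Longrightarrow> V \<in> \<V> \<Longrightarrow> U \<inter> V \<in> cover_join \<U> \<V>"
  by (auto simp: cover_join_def)

lemma cover_preimageI: "U \<in> \<U> \<Longrightarrow> {x \<in> topspace X. f x \<in> U} \<in> cover_preimage X f \<U>"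
  by (auto simp: cover_preimage_def)

lemma cover_join_eq_image: "cover_join \<U> \<V> = (\<lambda>(U, V). U \<inter> V) ` (\<U> \<times> \<V>)"
  by (auto simp: cover_join_def)

lemma cover_preimage_eq_image:
  "cover_preimage X f \<U> = (\<lambda>U. {x \<in> topspace X. f x \<in> U}) ` \<U>"
  by (auto simp: cover_preimage_def)

lemma Union_cover_join: "\<Union>(cover_join \<U> \<V>) = \<Union>\<U> \<inter> \<Union>\<V>"
  by (auto simp: cover_join_def)

text \<open>Pairwise intersections of two minimal subcovers still cover. After taking logarithms
  this is one half of subadditivity; the bound for preimages is the other.\<close>

lemma min_subcover_card_join:
  assumes X: "compact_space X" and U: "open_cover X \<U>" and V: "open_cover X \<V>"
  shows "min_subcover_card X (cover_join \<U> \<V>) \<le> min_subcover_card X \<U> * min_subcover_card X \<V>"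
proof -
  obtain \<A> where A: "\<A> \<subseteq> \<U>" "finite \<A>" "\<Union>\<A> = topspace X" "card \<A> = min_subcover_card X \<U>"
    by (rule min_subcover_card_attained[OF X U])
  obtain \<B> where B: "\<B> \<subseteq> \<V>" "finite \<B>" "\<Union>\<B> = topspace X" "card \<B> = min_subcover_card X \<V>"
    by (rule min_subcover_card_attained[OF X V])
  have "min_subcover_card X (cover_join \<U> \<V>) \<le> card (cover_join \<A> \<B>)"
  proof (rule min_subcover_card_le)
    show "cover_join \<A> \<B> \<subseteq> cover_join \<U> \<V>" using A(1) B(1) unfolding cover_join_def by blast
    show "finite (cover_join \<A> \<B>)" using A B by (simp add: cover_join_eq_image)
    show "\<Union>(cover_join \<A> \<B>) = topspace X" using A B by (simp add: Union_cover_join)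
  qed
  also have "\<dots> \<le> card (\<A> \<times> \<B>)" unfolding cover_join_eq_image
    by (rule card_image_le) (use A B in simp)
  finally show ?thesis using A B by (simp add: card_cartesian_product)
qed

lemma min_subcover_card_preimage:
  assumes "compact_space X" "open_cover X \<U>" and f: "f \<in> topspace X \<rightarrow> topspace X"
  shows "min_subcover_card X (cover_preimage X f \<U>) \<le> min_subcover_card X \<U>"
proof -
  obtain \<A> where A: "\<A> \<subseteq> \<U>" "finite \<A>" "\<Union>\<A> = topspace X" "card \<A> = min_subcover_card X \<U>"
    by (rule min_subcover_card_attained[OF assms(1,2)])
  have "min_subcover_card X (cover_preimage X f \<U>) \<le> card (cover_preimage X f \<A>)"
    using A f by (intro min_subcover_card_le) (auto simp: cover_preimage_eq_image Pi_iff)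
  also have "\<dots> \<le> card \<A>"
    unfolding cover_preimage_eq_image by (rule card_image_le) (use A in simp)
  finally show ?thesis using A by simp
qed

text \<open>A point of a nonempty member lies in no other member, so every subcover contains all
  nonempty members. The empty set is removed because joins of partitions produce empty
  intersections.\<close>

lemma
  assumes "compact_space X" "open_cover X \<U>" "disjoint (\<U> - {{}})"
  shows finite_disjoint_open_cover: "finite (\<U> - {{}})"
    and min_subcover_card_disjoint: "min_subcover_card X \<U> = card (\<U> - {{}})"
proof -
  obtain \<A> where A: "\<A> \<subseteq> \<U>" "finite \<A>" "\<Union>\<A> = topspace X" "card \<A> = min_subcover_card X \<U>"
    by (rule min_subcover_card_attained[OF assms(1,2)])
  have sub: "\<U> - {{}} \<subseteq> \<A>"
  proof
    fix U assume U: "U \<in> \<U> - {{}}"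
    then obtain x where x: "x \<in> U" by blast
    then have "x \<in> \<Union>\<A>" using U A(3) assms(2) by (auto simp: open_cover_def)
    then obtain V where V: "V \<in> \<A>" "x \<in> V" by blast
    then have "V \<in> \<U> - {{}}" using A(1) by blast
    with U V x have "U = V" using disjointD[OF assms(3)] by blast
    with V show "U \<in> \<A>" by simp
  qed
  show fin: "finite (\<U> - {{}})" by (rule finite_subset[OF sub A(2)])
  have "\<Union>(\<U> - {{}}) = topspace X" using assms(2) by (auto simp: open_cover_def)
  then have "min_subcover_card X \<U> \<le> card (\<U> - {{}})"
    by (intro min_subcover_card_le fin) auto
  moreover have "card (\<U> - {{}}) \<le> min_subcover_card X \<U>"
    using card_mono[OF A(2) sub] A(4) by simp
  ultimately show "min_subcover_card X \<U> = card (\<U> - {{}})" by simp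
qed

section \<open>Iterated joins and the entropy of a cover\<close>

lemma open_cover_join:
  "open_cover X \<U> \<Longrightarrow> open_cover X \<V> \<Longrightarrow> open_cover X (cover_join \<U> \<V>)"
  unfolding open_cover_def Union_cover_join by (auto simp: cover_join_def)

lemma open_cover_preimage:
  assumes "open_cover X \<U>" "continuous_map X X f"
  shows "open_cover X (cover_preimage X f \<U>)"
proof -
  have "\<Union>(cover_preimage X f \<U>) = {x \<in> topspace X. f x \<in> \<Union>\<U>}"
    by (auto simp: cover_preimage_def)
  also have "\<dots> = topspace X"
    using assms(1) continuous_map_image_subset_topspace[OF assms(2)]
    by (auto simp: open_cover_def)
  finally show ?thesis
    using assms by (auto simp: open_cover_def cover_preimage_def openin_continuous_map_preimage)
qed

lemma continuous_map_funpow: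
  "continuous_map X X f \<Longrightarrow> continuous_map X X (f ^^ n)"
  by (induction n) (auto intro: continuous_map_compose)

lemma open_cover_iterated_join:
  assumes "open_cover X \<U>" "continuous_map X X \<psi>"
  shows "open_cover X (iterated_join X \<psi> \<U> n)"
proof (induction n)
  case 0
  show ?case by (simp add: open_cover_def)
next
  case (Suc n)
  then show ?case
    by (simp add: open_cover_join open_cover_preimage[OF assms(1) continuous_map_funpow[OF assms(2)]])
qed

lemma cover_join_assoc: "cover_join (cover_join \<U> \<V>) \<W> = cover_join \<U> (cover_join \<V> \<W>)"
proof (rule subset_antisym; rule subsetI)
  fix A assume "A \<in> cover_join (cover_join \<U> \<V>) \<W>"
  then obtain U V W where "A = U \<inter> (V \<inter> W)" "U \<in> \<U>" "V \<in> \<V>" "W \<in> \<W>"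
    by (auto simp: cover_join_eq_image Int_assoc)
  then show "A \<in> cover_join \<U> (cover_join \<V> \<W>)" by (simp only: cover_joinI)
next
  fix A assume "A \<in> cover_join \<U> (cover_join \<V> \<W>)"
  then obtain U V W where "A = (U \<inter> V) \<inter> W" "U \<in> \<U>" "V \<in> \<V>" "W \<in> \<W>"
    by (auto simp: cover_join_eq_image Int_assoc)
  then show "A \<in> cover_join (cover_join \<U> \<V>) \<W>" by (simp only: cover_joinI)
qed

lemma cover_preimage_join:
  "cover_preimage X f (cover_join \<U> \<V>) = cover_join (cover_preimage X f \<U>) (cover_preimage X f \<V>)"
proof (rule Set.set_eqI)
  fix W
  have "W \<in> cover_preimage X f (cover_join \<U> \<V>) \<longleftrightarrow>
      (\<exists>U\<in>\<U>. \<exists>V\<in>\<V>. W = {x \<in> topspace X. f x \<in> U \<inter> V})"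
    unfolding cover_preimage_def cover_join_def by blast
  moreover have "W \<in> cover_join (cover_preimage X f \<U>) (cover_preimage X f \<V>) \<longleftrightarrow>
      (\<exists>U\<in>\<U>. \<exists>V\<in>\<V>. W = {x \<in> topspace X. f x \<in> U} \<inter> {x \<in> topspace X. f x \<in> V})"
    unfolding cover_preimage_def cover_join_def by blast
  moreover have "{x \<in> topspace X. f x \<in> U \<inter> V} =
      {x \<in> topspace X. f x \<in> U} \<inter> {x \<in> topspace X. f x \<in> V}" for U V
    by blast
  ultimately show "W \<in> cover_preimage X f (cover_join \<U> \<V>) \<longleftrightarrow>
      W \<in> cover_join (cover_preimage X f \<U>) (cover_preimage X f \<V>)"
    by (simp only:)
qed

text \<open>The preimages with exponents from \<open>m\<close> to \<open>m + n - 1\<close> are those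
  with exponents below \<open>n\<close>, pulled back along \<open>\<psi> ^^ m\<close>. This
  splitting is the source of subadditivity.\<close>

lemma iterated_join_add:
  assumes U: "open_cover X \<U>" and \<psi>: "continuous_map X X \<psi>"
  shows "iterated_join X \<psi> \<U> (m + n) =
    cover_join (iterated_join X \<psi> \<U> m) (cover_preimage X (\<psi> ^^ m) (iterated_join X \<psi> \<U> n))"
proof (induction n)
  case 0
  have "(\<psi> ^^ m) x \<in> topspace X" if "x \<in> topspace X" for x
    using continuous_map_image_subset_topspace[OF continuous_map_funpow[OF \<psi>]] that by blast
  then have "{x \<in> topspace X. (\<psi> ^^ m) x \<in> topspace X} = topspace X" by blast
  then have "cover_preimage X (\<psi> ^^ m) {topspace X} = {topspace X}"
    by (simp only: cover_preimage_eq_image image_insert image_empty)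
  \<comment> \<open>The trivial cover is neutral because the members of an open cover lie inside
    \<open>topspace X\<close>.\<close>
  moreover have "cover_join \<J> {topspace X} = \<J>" if "open_cover X \<J>" for \<J>
  proof -
    have "cover_join \<J> {topspace X} = (\<lambda>U. U \<inter> topspace X) ` \<J>"
      unfolding cover_join_def by blast
    also have "\<dots> = (\<lambda>U. U) ` \<J>"
    proof (rule image_cong)
      fix U assume "U \<in> \<J>"
      then have "U \<subseteq> topspace X" using that openin_subset by (auto simp only: open_cover_def)
      then show "U \<inter> topspace X = U" by blast
    qed simp
    finally show ?thesis by simp
  qed
  ultimately show ?case
    using open_cover_iterated_join[OF U \<psi>, of m] by (simp only: iterated_join.simps add_0_right)
next
  case (Suc n)
  have "(\<psi> ^^ m) x \<in> topspace X" if "x \<in> topspace X" for x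
    using continuous_map_image_subset_topspace[OF continuous_map_funpow[OF \<psi>]] that by blast
  moreover have "(\<psi> ^^ n) ((\<psi> ^^ m) x) = (\<psi> ^^ (m + n)) x" for x
    by (metis add.commute comp_apply funpow_add)
  ultimately have "{x \<in> topspace X. (\<psi> ^^ m) x \<in> {y \<in> topspace X. (\<psi> ^^ n) y \<in> U}} =
      {x \<in> topspace X. (\<psi> ^^ (m + n)) x \<in> U}" for U
    by (metis (no_types, lifting) mem_Collect_eq)
  then have "cover_preimage X (\<psi> ^^ m) (cover_preimage X (\<psi> ^^ n) \<U>) =
      cover_preimage X (\<psi> ^^ (m + n)) \<U>"
    by (simp only: cover_preimage_eq_image image_image)
  then show ?case
    by (simp only: add_Suc_right iterated_join.simps Suc.IH cover_preimage_join cover_join_assoc)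
qed

lemma iterated_join_refine:
  assumes "\<And>V. V \<in> \<V> \<Longrightarrow> \<exists>U\<in>\<U>. V \<subseteq> U"
  shows "V \<in> iterated_join X \<psi> \<V> n \<Longrightarrow> \<exists>U\<in>iterated_join X \<psi> \<U> n. V \<subseteq> U"
proof (induction n arbitrary: V)
  case (Suc n)
  from Suc.prems obtain A B where V: "V = A \<inter> {x \<in> topspace X. (\<psi> ^^ n) x \<in> B}"
    and A: "A \<in> iterated_join X \<psi> \<V> n" and B: "B \<in> \<V>"
    by (auto simp: cover_join_def cover_preimage_def)
  obtain A' where A': "A' \<in> iterated_join X \<psi> \<U> n" "A \<subseteq> A'" using Suc.IH[OF A] by blast
  obtain B' where B': "B' \<in> \<U>" "B \<subseteq> B'" using assms[OF B] by blast
  have "A' \<inter> {x \<in> topspace X. (\<psi> ^^ n) x \<in> B'} \<in> iterated_join X \<psi> \<U> (Suc n)"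
    unfolding iterated_join.simps by (intro cover_joinI cover_preimageI A' B')
  moreover have "V \<subseteq> A' \<inter> {x \<in> topspace X. (\<psi> ^^ n) x \<in> B'}" using V A' B' by blast
  ultimately show ?case by blast
qed simp

text \<open>Makes the \<open>lim\<close> in \<open>topological_entropy_wrt\<close> a genuine limit:
  the bounds for joins and preimages turn the splitting of the iterated join into subadditivity of
  the logarithms.\<close>

lemma convergent_cover_entropy:
  assumes X: "compact_space X" "topspace X \<noteq> {}"
    and U: "open_cover X \<U>" and \<psi>: "continuous_map X X \<psi>"
  shows "convergent (\<lambda>n. cover_entropy X (iterated_join X \<psi> \<U> n) / real n)"
proof (rule subadditive_convergent)
  let ?N = "\<lambda>n. min_subcover_card X (iterated_join X \<psi> \<U> n)"
  \<comment> \<open>On a nonempty space every count is at least one, so the logarithms are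
    nonnegative and monotone in the counts.\<close>
  have pos: "0 < ?N n" for n
    by (rule min_subcover_card_pos[OF X(1) open_cover_iterated_join[OF U \<psi>] X(2)])
  then show "0 \<le> cover_entropy X (iterated_join X \<psi> \<U> n)" for n
    unfolding cover_entropy_def by (simp add: Suc_leI)
  fix m n
  have "?N (m + n) \<le> ?N m * min_subcover_card X (cover_preimage X (\<psi> ^^ m) (iterated_join X \<psi> \<U> n))"
    unfolding iterated_join_add[OF U \<psi>]
    by (intro min_subcover_card_join X open_cover_preimage open_cover_iterated_join
        continuous_map_funpow U \<psi>)
  also have "\<dots> \<le> ?N m * ?N n"
    by (intro mult_left_mono min_subcover_card_preimage X open_cover_iterated_join U \<psi>
        continuous_map_funspace continuous_map_funpow) simp
  finally have "ln (real (?N (m + n))) \<le> ln (real (?N m) * real (?N n))"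
    using pos by (simp flip: of_nat_mult)
  also have "\<dots> = ln (real (?N m)) + ln (real (?N n))"
    using pos by (intro ln_mult_pos) simp_all
  finally show "cover_entropy X (iterated_join X \<psi> \<U> (m + n)) \<le>
      cover_entropy X (iterated_join X \<psi> \<U> m) + cover_entropy X (iterated_join X \<psi> \<U> n)"
    unfolding cover_entropy_def .
qed

text \<open>Refinement passes to the iterated joins, so the cover entropies compare for every
  \<open>n\<close>; both sequences converge and the limits inherit the inequality.\<close>

lemma topological_entropy_wrt_refine:
  assumes X: "compact_space X" "topspace X \<noteq> {}" and \<psi>: "continuous_map X X \<psi>"
    and U: "open_cover X \<U>" and V: "open_cover X \<V>"
    and refine: "\<And>V. V \<in> \<V> \<Longrightarrow> \<exists>U\<in>\<U>. V \<subseteq> U"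
  shows "topological_entropy_wrt X \<psi> \<U> \<le> topological_entropy_wrt X \<psi> \<V>"
  unfolding topological_entropy_wrt_def
proof (rule LIMSEQ_le)
  show "(\<lambda>n. cover_entropy X (iterated_join X \<psi> \<U> n) / real n)
      \<longlonglongrightarrow> lim (\<lambda>n. cover_entropy X (iterated_join X \<psi> \<U> n) / real n)"
    using convergent_cover_entropy[OF X U \<psi>] convergent_LIMSEQ_iff by blast
  show "(\<lambda>n. cover_entropy X (iterated_join X \<psi> \<V> n) / real n)
      \<longlonglongrightarrow> lim (\<lambda>n. cover_entropy X (iterated_join X \<psi> \<V> n) / real n)"
    using convergent_cover_entropy[OF X V \<psi>] convergent_LIMSEQ_iff by blast
  have Un: "open_cover X (iterated_join X \<psi> \<U> n)" and Vn: "open_cover X (iterated_join X \<psi> \<V> n)" for n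
    by (intro open_cover_iterated_join U V \<psi>)+
  have "cover_entropy X (iterated_join X \<psi> \<U> n) \<le> cover_entropy X (iterated_join X \<psi> \<V> n)" for n
  proof -
    have "min_subcover_card X (iterated_join X \<psi> \<U> n) \<le> min_subcover_card X (iterated_join X \<psi> \<V> n)"
      using Un[of n] by (intro min_subcover_card_refine X Vn iterated_join_refine refine)
        (auto simp: open_cover_def)
    then show ?thesis unfolding cover_entropy_def
      using min_subcover_card_pos[OF X(1) Un X(2), of n] by simp
  qed
  then show "\<exists>N. \<forall>n\<ge>N. cover_entropy X (iterated_join X \<psi> \<U> n) / real n
      \<le> cover_entropy X (iterated_join X \<psi> \<V> n) / real n"
    by (simp add: divide_right_mono)
qed

section \<open>Cosets of cotrajectories as members of iterated joins\<close>

section \<open>Covers by cosets\<close>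

context group
begin

lemma disjoint_rcosets: "subgroup N G \<Longrightarrow> disjoint (rcosets N)"
  using rcos_disjoint by (auto simp: pairwise_def disjnt_def disjoint_def)

lemma hom_funpow: "\<psi> \<in> hom G G \<Longrightarrow> \<psi> ^^ n \<in> hom G G"
  by (induction n) (auto simp: hom_def Pi_iff)

lemma subgroup_cotrajectory:
  assumes \<psi>: "\<psi> \<in> hom G G" and N: "subgroup N G"
  shows "subgroup (cotrajectory G \<psi> N n) G"
proof -
  interpret N: subgroup N G by (rule N)
  have h: "group_hom G G (\<psi> ^^ i)" for i
    using hom_funpow[OF \<psi>] by unfold_locales
  show ?thesis
    by (rule subgroupI)
      (auto simp: cotrajectory_def group_hom.hom_inv[OF h] group_hom.hom_mult[OF h]
        group_hom.hom_one[OF h] intro: exI[of _ \<one>])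
qed

text \<open>Since \<open>\<psi> ^^ i\<close> is a homomorphism, \<open>y\<close> times the inverse
  of \<open>x\<close> lies in the cotrajectory exactly when the iterates of \<open>x\<close> and
  \<open>y\<close> share their cosets of \<open>N\<close> at all times below \<open>n\<close>. In
  this form the coset is visibly an intersection of preimages.\<close>

lemma cotrajectory_coset:
  assumes \<psi>: "\<psi> \<in> hom G G" and N: "subgroup N G" and x: "x \<in> carrier G"
  shows "cotrajectory G \<psi> N n #> x = {y \<in> carrier G. \<forall>i<n. (\<psi> ^^ i) y \<in> N #> (\<psi> ^^ i) x}"
proof -
  have B: "subgroup (cotrajectory G \<psi> N n) G" by (rule subgroup_cotrajectory[OF \<psi> N])
  have h: "group_hom G G (\<psi> ^^ i)" for i
    using hom_funpow[OF \<psi>] by unfold_locales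
  have "y \<in> cotrajectory G \<psi> N n #> x \<longleftrightarrow> (\<forall>i<n. (\<psi> ^^ i) y \<in> N #> (\<psi> ^^ i) x)"
    if y: "y \<in> carrier G" for y
    unfolding subgroup.rcos_module[OF B is_group x y]
      subgroup.rcos_module[OF N is_group group_hom.hom_closed[OF h x] group_hom.hom_closed[OF h y]]
    using x y
    by (simp add: cotrajectory_def group_hom.hom_inv[OF h] group_hom.hom_mult[OF h])
  then show ?thesis
    using subgroup.elemrcos_carrier[OF B is_group x] by blast
qed

end

text \<open>Common ground for K and K/c, on which the two entropies are compared. Continuity is
  asked of each translation separately, since in this form it descends along the quotient map
  directly.\<close>

locale compact_semitopological_group = comm_group G for G (structure) +
  fixes T :: "'a topology"
  assumes topspace_carrier: "topspace T = carrier G"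
    and compact_carrier: "compact_space T"
    and continuous_translation: "x \<in> carrier G \<Longrightarrow> continuous_map T T (\<lambda>y. y \<otimes> x)"
begin

lemma openin_coset:
  assumes N: "subgroup N G" "openin T N" and x: "x \<in> carrier G"
  shows "openin T (N #> x)"
proof -
  have "N #> x = {y \<in> topspace T. y \<otimes> inv x \<in> N}"
    using subgroup.rcos_module[OF N(1) is_group x] subgroup.elemrcos_carrier[OF N(1) is_group x]
    by (auto simp: topspace_carrier)
  then show ?thesis
    using openin_continuous_map_preimage[OF continuous_translation N(2)] x by simp
qed

lemma open_cover_rcosets:
  assumes "subgroup N G" "openin T N"
  shows "open_cover T (rcosets N)"
  unfolding open_cover_def using openin_coset[OF assms] rcosets_part_G[OF assms(1)]
  by (auto simp: RCOSETS_def topspace_carrier)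

text \<open>The cosets of an open subgroup partition a compact space into open sets, so there are
  finitely many of them. The adjoint entropy is thus a supremum over all open subgroups.\<close>

lemma open_finite_index_subgroups_eq:
  "open_finite_index_subgroups G T = {N. subgroup N G \<and> openin T N}"
proof -
  have "finite (rcosets N)" if N: "subgroup N G" "openin T N" for N
  proof -
    have "rcosets N - {{}} = rcosets N"
      using rcos_self[OF _ N(1)] by (auto simp: RCOSETS_def)
    then show ?thesis
      using finite_disjoint_open_cover[OF compact_carrier open_cover_rcosets[OF N]]
        disjoint_rcosets[OF N(1)] by simp
  qed
  then show ?thesis
    by (auto simp: open_finite_index_subgroups_def finite_index_subgroups_def)
qed

text \<open>A member of the join that contains \<open>x\<close> has to use the coset of each iterate
  of \<open>x\<close>, so it is the coset of the cotrajectory through \<open>x\<close>. Incompatible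
  choices of cosets give the empty set.\<close>

lemma iterated_join_rcosets:
  assumes \<psi>: "\<psi> \<in> hom G G" and N: "subgroup N G"
  shows "iterated_join T \<psi> (rcosets N) n - {{}} = rcosets (cotrajectory G \<psi> N n)"
proof -
  note coset = cotrajectory_coset[OF \<psi> N]
  have closed: "(\<psi> ^^ i) x \<in> carrier G" if "x \<in> carrier G" for i x
    using hom_funpow[OF \<psi>] that by (auto simp: hom_def)
  \<comment> \<open>Mirrors the recursion of \<open>iterated_join\<close>, so that both inclusions
    follow by induction on \<open>n\<close>.\<close>
  have step: "cotrajectory G \<psi> N (Suc n) #> x =
      (cotrajectory G \<psi> N n #> x) \<inter> {y \<in> topspace T. (\<psi> ^^ n) y \<in> N #> (\<psi> ^^ n) x}"
    if "x \<in> carrier G" for n x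
    unfolding coset[OF that] by (auto simp: less_Suc_eq topspace_carrier)
  have coset_in: "cotrajectory G \<psi> N n #> x \<in> iterated_join T \<psi> (rcosets N) n"
    if x: "x \<in> carrier G" for x n
  proof (induction n)
    case 0
    show ?case unfolding coset[OF x] by (simp add: topspace_carrier)
  next
    case (Suc n)
    have "N #> (\<psi> ^^ n) x \<in> rcosets N"
      using closed[OF x] by (rule rcosetsI[OF subgroup.subset[OF N]])
    then show ?case
      unfolding step[OF x] iterated_join.simps by (intro cover_joinI cover_preimageI Suc)
  qed
  have in_coset: "W = cotrajectory G \<psi> N n #> x"
    if "W \<in> iterated_join T \<psi> (rcosets N) n" "x \<in> W" "x \<in> carrier G" for W x n
    using that
  proof (induction n arbitrary: W)
    case 0
    then show ?case unfolding coset[OF \<open>x \<in> carrier G\<close>] by (simp add: topspace_carrier)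
  next
    case (Suc n)
    from Suc.prems(1) obtain A C where W: "W = A \<inter> {y \<in> topspace T. (\<psi> ^^ n) y \<in> C}"
      and A: "A \<in> iterated_join T \<psi> (rcosets N) n" and C: "C \<in> rcosets N"
      by (auto simp: cover_join_def cover_preimage_def)
    have A': "A = cotrajectory G \<psi> N n #> x"
      using Suc.IH[OF A] Suc.prems W by blast
    obtain z where z: "z \<in> carrier G" "C = N #> z" using C by (auto simp: RCOSETS_def)
    have "(\<psi> ^^ n) x \<in> N #> z" using Suc.prems(2) W z(2) by blast
    then have "C = N #> (\<psi> ^^ n) x" using repr_independence[OF _ z(1) N] z(2) by simp
    then show ?case unfolding step[OF Suc.prems(3)] W A' by simp
  qed
  have carrier: "W \<subseteq> carrier G" if "W \<in> iterated_join T \<psi> (rcosets N) n" for W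
    using that
  proof (cases n)
    case (Suc k)
    then show ?thesis
      using that by (auto simp: cover_join_def cover_preimage_def topspace_carrier)
  qed (simp add: topspace_carrier)
  show ?thesis
  proof (rule subset_antisym; rule subsetI)
    fix W assume W: "W \<in> iterated_join T \<psi> (rcosets N) n - {{}}"
    then obtain x where x: "x \<in> W" by blast
    then have "x \<in> carrier G" using carrier W by blast
    with W x have "W = cotrajectory G \<psi> N n #> x" using in_coset by simp
    with \<open>x \<in> carrier G\<close> show "W \<in> rcosets (cotrajectory G \<psi> N n)"
      by (auto simp: RCOSETS_def)
  next
    fix W assume "W \<in> rcosets (cotrajectory G \<psi> N n)"
    then obtain x where x: "x \<in> carrier G" "W = cotrajectory G \<psi> N n #> x"
      by (auto simp: RCOSETS_def)
    moreover have "x \<in> W" unfolding x(2) by (rule rcos_self[OF x(1) subgroup_cotrajectory[OF \<psi> N]])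
    ultimately show "W \<in> iterated_join T \<psi> (rcosets N) n - {{}}" using coset_in by blast
  qed
qed

text \<open>The nonempty members of each join are disjoint, so a minimal subcover has as many
  members as the cotrajectory has cosets. The two sequences agree term by term.\<close>

lemma topological_entropy_wrt_rcosets:
  assumes \<psi>: "\<psi> \<in> hom G G" "continuous_map T T \<psi>" and N: "subgroup N G" "openin T N"
  shows "topological_entropy_wrt T \<psi> (rcosets N) = adjoint_entropy_wrt G \<psi> N"
proof -
  have "min_subcover_card T (iterated_join T \<psi> (rcosets N) n) =
      card (carrier (cotrajectory_quotient G \<psi> N n))" for n
  proof -
    have "min_subcover_card T (iterated_join T \<psi> (rcosets N) n) =
        card (iterated_join T \<psi> (rcosets N) n - {{}})"
      using disjoint_rcosets[OF subgroup_cotrajectory[OF \<psi>(1) N(1)]]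
      by (intro min_subcover_card_disjoint compact_carrier open_cover_iterated_join \<psi>(2)
          open_cover_rcosets N) (simp only: iterated_join_rcosets[OF \<psi>(1) N(1)])
    then show ?thesis
      by (simp only: iterated_join_rcosets[OF \<psi>(1) N(1)] cotrajectory_quotient_def FactGroup_def
          partial_object.simps)
  qed
  then show ?thesis
    by (simp add: topological_entropy_wrt_def cover_entropy_def adjoint_entropy_wrt_def)
qed

text \<open>Coset covers are open covers, which gives one inequality; \<open>refine\<close> and
  monotonicity under refinement give the other. The assumption \<open>refine\<close> is verified
  later for K/c and for totally disconnected K.\<close>

lemma topological_adjoint_entropy_eq_topological_entropy:
  assumes \<psi>: "\<psi> \<in> hom G G" "continuous_map T T \<psi>"
    and refine: "\<And>\<U>. open_cover T \<U> \<Longrightarrow>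
      \<exists>N. subgroup N G \<and> openin T N \<and> (\<forall>C\<in>rcosets N. \<exists>U\<in>\<U>. C \<subseteq> U)"
  shows "topological_adjoint_entropy G T \<psi> = topological_entropy T \<psi>"
  unfolding topological_adjoint_entropy_def topological_entropy_def open_finite_index_subgroups_eq
proof (rule antisym; rule SUP_mono)
  fix N assume "N \<in> {N. subgroup N G \<and> openin T N}"
  then have N: "subgroup N G" "openin T N" by auto
  show "\<exists>\<U>\<in>{\<U>. open_cover T \<U>}.
      ereal (adjoint_entropy_wrt G \<psi> N) \<le> ereal (topological_entropy_wrt T \<psi> \<U>)"
    using open_cover_rcosets[OF N] topological_entropy_wrt_rcosets[OF \<psi> N]
    by (intro bexI[of _ "rcosets N"]) simp_all
next
  fix \<U> assume "\<U> \<in> {\<U>. open_cover T \<U>}"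
  then have U: "open_cover T \<U>" by simp
  from refine[OF U] obtain N
    where N: "subgroup N G" "openin T N" "\<forall>C\<in>rcosets N. \<exists>U\<in>\<U>. C \<subseteq> U"
    by blast
  have "topspace T \<noteq> {}" unfolding topspace_carrier using one_closed by blast
  then have "topological_entropy_wrt T \<psi> \<U> \<le> topological_entropy_wrt T \<psi> (rcosets N)"
    using N(3) by (intro topological_entropy_wrt_refine compact_carrier \<psi>(2) U
        open_cover_rcosets N(1,2)) blast+
  then show "\<exists>N\<in>{N. subgroup N G \<and> openin T N}.
      ereal (topological_entropy_wrt T \<psi> \<U>) \<le> ereal (adjoint_entropy_wrt G \<psi> N)"
    using N topological_entropy_wrt_rcosets[OF \<psi> N(1,2)] by (intro bexI[of _ N]) simp_all
qed

end

section \<open>Pullback of subgroups, cosets and cotrajectories\<close>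

section \<open>Pulling subgroups back along a surjection\<close>

text \<open>A subgroup containing \<open>H\<close> is a union of cosets of \<open>H\<close>, so
  passing to the quotient and back loses nothing.\<close>

lemma (in group) vimage_coset_map_image:
  assumes H: "subgroup H G" and N: "subgroup N G" and HN: "H \<subseteq> N"
  shows "{x \<in> carrier G. H #> x \<in> (\<lambda>x. H #> x) ` N} = N"
proof (rule subset_antisym; rule subsetI)
  fix x assume "x \<in> {x \<in> carrier G. H #> x \<in> (\<lambda>x. H #> x) ` N}"
  then obtain y where x: "x \<in> carrier G" and y: "y \<in> N" "H #> x = H #> y" by auto
  then have "x \<in> H #> y" using rcos_self[OF x H] by simp
  then obtain z where z: "z \<in> H" "x = z \<otimes> y" by (auto simp: r_coset_def)
  then show "x \<in> N" using HN y(1) subgroup.m_closed[OF N] by blast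
next
  fix x assume "x \<in> N"
  then show "x \<in> {x \<in> carrier G. H #> x \<in> (\<lambda>x. H #> x) ` N}"
    using subgroup.subset[OF N] by blast
qed

context group_hom
begin

lemma vimage_subgroup:
  assumes M: "subgroup M H"
  shows "subgroup {x \<in> carrier G. h x \<in> M} G"
proof -
  interpret M: subgroup M H by (rule M)
  show ?thesis by (rule G.subgroupI) (auto intro: exI[of _ "\<one>\<^bsub>G\<^esub>"])
qed

lemma vimage_coset:
  assumes M: "subgroup M H" and x: "x \<in> carrier G"
  shows "{y \<in> carrier G. h y \<in> M #>\<^bsub>H\<^esub> h x} = {y \<in> carrier G. h y \<in> M} #>\<^bsub>G\<^esub> x"
proof -
  note N = vimage_subgroup[OF M]
  have "h y \<in> M #>\<^bsub>H\<^esub> h x \<longleftrightarrow> y \<in> {y \<in> carrier G. h y \<in> M} #>\<^bsub>G\<^esub> x"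
    if y: "y \<in> carrier G" for y
    unfolding subgroup.rcos_module[OF N G.is_group x y]
      subgroup.rcos_module[OF M H.is_group hom_closed[OF x] hom_closed[OF y]]
    using x y by simp
  then show ?thesis using subgroup.elemrcos_carrier[OF N G.is_group x] by blast
qed

lemma bij_betw_vimage_rcosets:
  assumes surj: "h ` carrier G = carrier H" and M: "subgroup M H"
  shows "bij_betw (\<lambda>C. {x \<in> carrier G. h x \<in> C}) (rcosets\<^bsub>H\<^esub> M)
    (rcosets\<^bsub>G\<^esub> {x \<in> carrier G. h x \<in> M})"
  unfolding bij_betw_def
proof
  show "inj_on (\<lambda>C. {x \<in> carrier G. h x \<in> C}) (rcosets\<^bsub>H\<^esub> M)"
  proof (rule inj_onI)
    fix C D assume CD: "C \<in> rcosets\<^bsub>H\<^esub> M" "D \<in> rcosets\<^bsub>H\<^esub> M"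
      and eq: "{x \<in> carrier G. h x \<in> C} = {x \<in> carrier G. h x \<in> D}"
    \<comment> \<open>Surjectivity lets a coset be recovered from its preimage, which is injectivity
      of the pullback.\<close>
    have image: "C = h ` {x \<in> carrier G. h x \<in> C}" if "C \<in> rcosets\<^bsub>H\<^esub> M" for C
    proof -
      have "C \<subseteq> h ` carrier G"
        using that H.rcosets_part_G[OF M] unfolding surj by blast
      then show ?thesis by blast
    qed
    show "C = D" using image[OF CD(1)] image[OF CD(2)] unfolding eq by simp
  qed
  have "(\<lambda>C. {x \<in> carrier G. h x \<in> C}) ` (rcosets\<^bsub>H\<^esub> M) =
      (\<lambda>x. {y \<in> carrier G. h y \<in> M #>\<^bsub>H\<^esub> h x}) ` carrier G"
    unfolding RCOSETS_def surj[symmetric] by auto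
  also have "\<dots> = (\<lambda>x. {y \<in> carrier G. h y \<in> M} #>\<^bsub>G\<^esub> x) ` carrier G"
    by (rule image_cong) (simp_all add: vimage_coset[OF M])
  also have "\<dots> = rcosets\<^bsub>G\<^esub> {y \<in> carrier G. h y \<in> M}"
    unfolding RCOSETS_def by auto
  finally show "(\<lambda>C. {x \<in> carrier G. h x \<in> C}) ` (rcosets\<^bsub>H\<^esub> M) =
      rcosets\<^bsub>G\<^esub> {x \<in> carrier G. h x \<in> M}" .
qed

text \<open>The semiconjugacy \<open>semi\<close> extends to all iterates, so pulling back commutes
  with forming cotrajectories.\<close>

lemma cotrajectory_vimage:
  assumes \<phi>: "\<phi> \<in> carrier G \<rightarrow> carrier G"
    and semi: "\<And>x. x \<in> carrier G \<Longrightarrow> h (\<phi> x) = \<theta> (h x)"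
  shows "cotrajectory G \<phi> {x \<in> carrier G. h x \<in> M} n = {x \<in> carrier G. h x \<in> cotrajectory H \<theta> M n}"
proof -
  have "(\<phi> ^^ i) x \<in> carrier G \<and> h ((\<phi> ^^ i) x) = (\<theta> ^^ i) (h x)" if "x \<in> carrier G" for i x
    by (induction i) (use that \<phi> semi in \<open>auto simp: Pi_iff\<close>)
  then show ?thesis by (auto simp: cotrajectory_def)
qed

text \<open>Pullback is a bijection between the cosets of corresponding cotrajectories, so both
  limits are taken of the same sequence.\<close>

lemma adjoint_entropy_wrt_vimage:
  assumes surj: "h ` carrier G = carrier H" and \<phi>: "\<phi> \<in> carrier G \<rightarrow> carrier G"
    and semi: "\<And>x. x \<in> carrier G \<Longrightarrow> h (\<phi> x) = \<theta> (h x)"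
    and B: "\<And>n. subgroup (cotrajectory H \<theta> M n) H"
  shows "adjoint_entropy_wrt G \<phi> {x \<in> carrier G. h x \<in> M} = adjoint_entropy_wrt H \<theta> M"
proof -
  have "card (carrier (cotrajectory_quotient G \<phi> {x \<in> carrier G. h x \<in> M} n)) =
      card (carrier (cotrajectory_quotient H \<theta> M n))" for n
    using bij_betw_same_card[OF bij_betw_vimage_rcosets[OF surj B, of n]]
    by (simp only: cotrajectory_quotient_def FactGroup_def partial_object.simps
        cotrajectory_vimage[OF \<phi> semi])
  then show ?thesis by (simp only: adjoint_entropy_wrt_def)
qed

end

section \<open>Passage to the quotient by the identity component\<close>

section \<open>Quotients of compact abelian groups\<close>

context compact_abelian_group
begin

lemma continuous_right_translation: "x \<in> carrier G \<Longrightarrow> continuous_map T T (\<lambda>y. y \<otimes> x)"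
  using continuous_map_compose[OF _ continuous_mult, of T "\<lambda>y. (y, x)"]
  by (simp add: continuous_map_pairedI topspace_eq_carrier o_def)

lemma compact_semitopological: "compact_semitopological_group G T"
  by unfold_locales (rule topspace_eq_carrier compact continuous_right_translation; assumption?)+

lemma group_hom_coset_map:
  assumes "subgroup H G"
  shows "group_hom G (G Mod H) (\<lambda>x. H #> x)"
proof -
  interpret N: normal H G using assms normal_iff_subgroup by blast
  show ?thesis
    by (intro group_hom.intro group_hom_axioms.intro is_group N.factorgroup_is_group N.r_coset_hom_Mod)
qed

lemma compact_semitopological_quotient:
  assumes H: "subgroup H G"
  shows "compact_semitopological_group (G Mod H) (quotient_group_topology G T H)"
proof -
  let ?Q = "quotient_group_topology G T H"
  interpret Q: comm_group "G Mod H" by (rule abelian_FactGroup[OF H])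
  interpret \<pi>: group_hom G "G Mod H" "\<lambda>x. H #> x" by (rule group_hom_coset_map[OF H])
  note cont = quotient_imp_continuous_map[OF quotient_map_cosets[of H]]
  show ?thesis
  proof unfold_locales
    show "topspace ?Q = carrier (G Mod H)" by (rule topspace_quotient_group_topology)
    show "compact_space ?Q"
      using image_compactin[OF _ cont] compact quotient_imp_surjective_map[OF quotient_map_cosets[of H]]
      by (metis compact_space_def)
    fix C assume "C \<in> carrier (G Mod H)"
    then obtain x where x: "x \<in> carrier G" "C = H #> x" by (auto simp: carrier_FactGroup)
    \<comment> \<open>Translation by the coset of \<open>x\<close> is induced by translation by
      \<open>x\<close>; the universal property of the quotient map then yields its
      continuity.\<close>
    have "continuous_map T ?Q ((\<lambda>y. H #> y) \<circ> (\<lambda>y. y \<otimes> x))"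
      using continuous_right_translation[OF x(1)] cont by (rule continuous_map_compose)
    then have "continuous_map T ?Q ((\<lambda>D. D \<otimes>\<^bsub>G Mod H\<^esub> C) \<circ> (\<lambda>y. H #> y))"
      by (rule continuous_map_eq)
        (use \<pi>.hom_mult[OF _ x(1)] in \<open>simp add: x(2) topspace_eq_carrier\<close>)
    then show "continuous_map ?Q ?Q (\<lambda>D. D \<otimes>\<^bsub>G Mod H\<^esub> C)"
      using continuous_compose_quotient_map[OF quotient_map_cosets] by blast
  qed
qed

text \<open>The other cosets of \<open>N\<close> are open, so \<open>N\<close> is clopen; a
  connected set that meets it in the identity stays inside.\<close>

lemma identity_component_subset_open_subgroup:
  assumes N: "subgroup N G" "openin T N"
  shows "identity_component G T \<subseteq> N"
proof -
  interpret C: compact_semitopological_group G T by (rule compact_semitopological)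
  have open_rest: "openin T (\<Union>(rcosets N - {N}))"
    using C.open_cover_rcosets[OF N] unfolding open_cover_def by blast
  have "N \<in> rcosets N"
    using rcosetsI[OF subgroup.subset[OF N(1)] one_closed] coset_join2[OF one_closed N(1)]
      subgroup.one_closed[OF N(1)] by simp
  then have "W \<inter> N = {}" if "W \<in> rcosets N - {N}" for W
    using disjointD[OF disjoint_rcosets[OF N(1)]] that by blast
  then have "\<Union>(rcosets N - {N}) = topspace T - N"
    using rcosets_part_G[OF N(1)] \<open>N \<in> rcosets N\<close> unfolding topspace_eq_carrier by blast
  then have "closedin T N"
    using open_rest openin_subset[OF N(2)] by (simp add: closedin_def)
  moreover have "\<one> \<in> N" by (rule subgroup.one_closed[OF N(1)])
  ultimately show ?thesis
    unfolding identity_component_def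
    using connectedin_clopen_cases[OF connectedin_connected_component_of _ N(2), of \<one>]
    by (auto simp: disjnt_iff connected_component_of_refl topspace_eq_carrier)
qed

text \<open>Pulling back maps the open subgroups of K/c onto those of K and preserves the entropy of
  each, so both suprema are over the same values.\<close>

lemma topological_adjoint_entropy_quotient:
  assumes \<phi>: "\<phi> \<in> hom G G" "continuous_map T T \<phi>"
  defines "c \<equiv> identity_component G T"
  shows "topological_adjoint_entropy G T \<phi> =
    topological_adjoint_entropy (G Mod c) (quotient_group_topology G T c) (induced_endo G c \<phi>)"
proof -
  let ?Q = "quotient_group_topology G T c" and ?\<theta> = "induced_endo G c \<phi>"
  let ?pull = "\<lambda>M. {x \<in> carrier G. c #> x \<in> M}"
  have c: "subgroup c G" unfolding c_def by (rule subgroup_identity_component)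
  have inv: "\<phi> ` c \<subseteq> c" unfolding c_def by (rule identity_component_invariant[OF \<phi>])
  interpret \<pi>: group_hom G "G Mod c" "\<lambda>x. c #> x" by (rule group_hom_coset_map[OF c])
  interpret C: compact_semitopological_group G T by (rule compact_semitopological)
  interpret Q: compact_semitopological_group "G Mod c" ?Q
    by (rule compact_semitopological_quotient[OF c])
  have surj: "(\<lambda>x. c #> x) ` carrier G = carrier (G Mod c)" by (auto simp: carrier_FactGroup)
  have entropy: "adjoint_entropy_wrt G \<phi> (?pull M) = adjoint_entropy_wrt (G Mod c) ?\<theta> M"
    if "subgroup M (G Mod c)" for M
    using \<phi>(1)
    by (intro \<pi>.adjoint_entropy_wrt_vimage surj \<pi>.H.subgroup_cotrajectory that
        induced_endo_hom[OF \<phi>(1) c inv] induced_endo_coset[OF \<phi>(1) c inv, symmetric])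
      (auto simp: hom_def)
  \<comment> \<open>An open subgroup contains \<open>c\<close>, so it is the pullback of its image,
    and that image is open by definition of the quotient topology.\<close>
  have pull: "{N. subgroup N G \<and> openin T N} = ?pull ` {M. subgroup M (G Mod c) \<and> openin ?Q M}"
  proof (rule subset_antisym; rule subsetI)
    fix N assume "N \<in> {N. subgroup N G \<and> openin T N}"
    then have N: "subgroup N G" "openin T N" by auto
    have cN: "c \<subseteq> N" unfolding c_def by (rule identity_component_subset_open_subgroup[OF N])
    note N_eq = vimage_coset_map_image[OF c N(1) cN]
    have "subgroup ((\<lambda>x. c #> x) ` N) (G Mod c)" by (rule \<pi>.subgroup_img_is_subgroup[OF N(1)])
    moreover have "openin ?Q ((\<lambda>x. c #> x) ` N)"
      unfolding openin_quotient_group_topology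
      using N_eq N(2) subgroup.subset[OF calculation] by (simp add: topspace_eq_carrier)
    ultimately show "N \<in> ?pull ` {M. subgroup M (G Mod c) \<and> openin ?Q M}"
      using N_eq by (intro image_eqI[of _ _ "(\<lambda>x. c #> x) ` N"]) simp_all
  next
    fix N assume "N \<in> ?pull ` {M. subgroup M (G Mod c) \<and> openin ?Q M}"
    then obtain M where M: "subgroup M (G Mod c)" "openin ?Q M" and N: "N = ?pull M" by auto
    show "N \<in> {N. subgroup N G \<and> openin T N}"
      using \<pi>.vimage_subgroup[OF M(1)] M(2)
      by (simp add: N openin_quotient_group_topology topspace_eq_carrier)
  qed
  show ?thesis
    unfolding topological_adjoint_entropy_def C.open_finite_index_subgroups_eq
      Q.open_finite_index_subgroups_eq pull image_image
    by (rule SUP_cong) (simp_all add: entropy)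
qed

section \<open>Small open subgroups and refinement of covers by their cosets\<close>

text \<open>The witness is the stabiliser of the compact open set \<open>U\<close> under translation.\<close>

lemma open_subgroup_in_clopen:
  assumes U: "openin T U" "closedin T U" "\<one> \<in> U"
  obtains N where "subgroup N G" "openin T N" "N \<subseteq> U"
proof -
  define A where "A = {x \<in> carrier G. \<forall>u\<in>U. x \<otimes> u \<in> U}"
  have Uc: "U \<subseteq> carrier G" using openin_subset[OF U(1)] by (simp add: topspace_eq_carrier)
  have A_open: "openin T A"
  proof (subst openin_subopen, intro ballI)
    fix x assume x: "x \<in> A"
    \<comment> \<open>Tube lemma: \<open>?W\<close> is open and contains
      \<open>{x} \<times> U\<close> with \<open>U\<close> compact, so it contains
      \<open>O' \<times> U\<close> for some open \<open>O'\<close> around \<open>x\<close>, and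
      \<open>O'\<close> lies in \<open>A\<close>.\<close>
    let ?W = "{p \<in> topspace (prod_topology T T). (\<lambda>(x, y). x \<otimes> y) p \<in> U}"
    have "openin (prod_topology T T) ?W"
      by (rule openin_continuous_map_preimage[OF continuous_mult U(1)])
    moreover have "compactin T U" by (rule closedin_compact_space[OF compact U(2)])
    moreover have "x \<in> topspace T" using x by (simp add: A_def topspace_eq_carrier)
    moreover have "{x} \<times> U \<subseteq> ?W" using x Uc by (auto simp: A_def topspace_eq_carrier)
    ultimately have "\<exists>O' V. openin T O' \<and> openin T V \<and> x \<in> O' \<and> U \<subseteq> V \<and> O' \<times> V \<subseteq> ?W"
      by (rule Abstract_Topological_Spaces.tube_lemma_right)
    then obtain O' V where O': "openin T O'" "x \<in> O'" "U \<subseteq> V" "O' \<times> V \<subseteq> ?W" by blast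
    have "O' \<subseteq> A"
    proof
      fix y assume y: "y \<in> O'"
      then have "y \<in> carrier G" using openin_subset[OF O'(1)] topspace_eq_carrier by blast
      moreover have "y \<otimes> u \<in> U" if "u \<in> U" for u
      proof -
        have "(y, u) \<in> ?W" using O'(3) y that by (intro subsetD[OF O'(4)]) auto
        then show ?thesis by simp
      qed
      ultimately show "y \<in> A" by (simp add: A_def)
    qed
    with O' show "\<exists>S. openin T S \<and> x \<in> S \<and> S \<subseteq> A" by blast
  qed
  \<comment> \<open>\<open>A\<close> only says that translation maps \<open>U\<close> into itself;
    requiring this of the inverse too makes \<open>N\<close> closed under inverses.\<close>
  define N where "N = A \<inter> {x \<in> topspace T. inv x \<in> A}"
  have "openin T N" unfolding N_def
    by (intro openin_Int A_open openin_continuous_map_preimage[OF continuous_inv])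
  moreover have mult: "x \<otimes> y \<in> A" if "x \<in> A" "y \<in> A" for x y
    using that Uc by (auto simp: A_def m_assoc subset_iff)
  have "subgroup N G"
  proof (rule subgroupI)
    show "N \<subseteq> carrier G" by (auto simp: N_def A_def)
    have "\<one> \<in> A" using Uc by (auto simp: A_def subset_iff)
    then show "N \<noteq> {}" by (auto simp: N_def topspace_eq_carrier)
  next
    fix x assume "x \<in> N"
    then show "inv x \<in> N" by (auto simp: N_def topspace_eq_carrier)
  next
    fix x y assume "x \<in> N" "y \<in> N"
    then show "x \<otimes> y \<in> N" using mult by (auto simp: N_def topspace_eq_carrier inv_mult)
  qed
  moreover have "N \<subseteq> U"
  proof
    fix x assume "x \<in> N"
    then have "x \<in> carrier G" "x \<otimes> \<one> \<in> U" using U(3) by (auto simp: N_def A_def)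
    then show "x \<in> U" by simp
  qed
  ultimately show thesis using that by blast
qed

text \<open>In a compact Hausdorff space components are quasi-components, so a clopen set separates
  the identity component from the compact complement of \<open>V\<close>. The clopen set then
  contains an open subgroup.\<close>

lemma open_subgroup_in_neighbourhood:
  assumes V: "openin T V" and c: "identity_component G T \<subseteq> V"
  obtains N where "subgroup N G" "openin T N" "N \<subseteq> V"
proof -
  have "quasi_component_of_set T \<one> = identity_component G T"
    unfolding identity_component_def
    using quasi_eq_connected_component_of[of T \<one>] compact Hausdorff by simp
  moreover have "quasi_component_of_set T \<one> \<in> quasi_components_of T"
    by (auto simp: quasi_components_of_def topspace_eq_carrier)
  moreover have "compactin T (topspace T - V)"
    by (intro closedin_compact_space compact closedin_diff closedin_topspace V)
  moreover have "disjnt (identity_component G T) (topspace T - V)"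
    using c by (auto simp: disjnt_def)
  ultimately have "separated_between T (identity_component G T) (topspace T - V)"
    by (simp add: separated_between_quasi_component_compact)
  then obtain U where U: "closedin T U" "openin T U" "identity_component G T \<subseteq> U"
      "topspace T - V \<subseteq> topspace T - U"
    by (auto simp: separated_between)
  have "\<one> \<in> U" using U(3) subgroup.one_closed[OF subgroup_identity_component] by blast
  with U(2,1) obtain N where N: "subgroup N G" "openin T N" "N \<subseteq> U"
    by (rule open_subgroup_in_clopen)
  have "U \<subseteq> V" using U(4) openin_subset[OF U(2)] by blast
  with N that show thesis by blast
qed

text \<open>A Lebesgue number argument with subgroups in place of radii: each point has its own open
  subgroup, and the intersection of finitely many of them serves all points.\<close>

lemma saturated_open_cover_refinement:
  assumes U: "open_cover T \<U>"
    and sat: "\<And>V x. V \<in> \<U> \<Longrightarrow> x \<in> V \<Longrightarrow> identity_component G T #> x \<subseteq> V"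
  obtains N where "subgroup N G" "openin T N" "\<forall>x\<in>carrier G. \<exists>V\<in>\<U>. N #> x \<subseteq> V"
proof -
  interpret C: compact_semitopological_group G T by (rule compact_semitopological)
  have "\<exists>N V. subgroup N G \<and> openin T N \<and> V \<in> \<U> \<and> N #> x \<subseteq> V" if x: "x \<in> carrier G" for x
  proof -
    have "x \<in> \<Union>\<U>" using x U by (simp add: open_cover_def topspace_eq_carrier)
    then obtain V where V: "V \<in> \<U>" "x \<in> V" by blast
    \<comment> \<open>Shifting \<open>V\<close> back by \<open>x\<close> moves the saturated set to
      the identity, where it becomes a neighbourhood of the whole identity component.\<close>
    let ?V = "{y \<in> topspace T. y \<otimes> x \<in> V}"
    have "openin T V" using U V(1) by (simp add: open_cover_def)
    then have "openin T ?V"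
      by (rule openin_continuous_map_preimage[OF continuous_right_translation[OF x]])
    moreover have "identity_component G T \<subseteq> ?V"
      using sat[OF V] subgroup.subset[OF subgroup_identity_component]
      by (auto simp: r_coset_def topspace_eq_carrier)
    ultimately obtain N where N: "subgroup N G" "openin T N" "N \<subseteq> ?V"
      by (rule open_subgroup_in_neighbourhood)
    then have "N #> x \<subseteq> V" by (auto simp: r_coset_def)
    with N V(1) show ?thesis by blast
  qed
  then obtain N V where NV: "\<And>x. x \<in> carrier G \<Longrightarrow> subgroup (N x) G \<and> openin T (N x) \<and>
      V x \<in> \<U> \<and> N x #> x \<subseteq> V x"
    by metis
  have self: "x \<in> N x #> x" if "x \<in> carrier G" for x
    using rcos_self[OF that] NV[OF that] by blast
  have "openin T W" if "W \<in> (\<lambda>x. N x #> x) ` carrier G" for W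
    using that NV C.openin_coset by blast
  moreover have "topspace T \<subseteq> \<Union>((\<lambda>x. N x #> x) ` carrier G)"
    using self by (auto simp: topspace_eq_carrier)
  ultimately have "\<exists>\<F>. finite \<F> \<and> \<F> \<subseteq> (\<lambda>x. N x #> x) ` carrier G \<and> topspace T \<subseteq> \<Union>\<F>"
    by (rule compactinD[OF compact[unfolded compact_space_def]])
  then obtain F where F: "finite F" "F \<subseteq> carrier G" "carrier G \<subseteq> (\<Union>x\<in>F. N x #> x)"
    unfolding topspace_eq_carrier ex_finite_subset_image by blast
  \<comment> \<open>An empty \<open>F\<close> would turn \<open>?N\<close> into the whole
    type.\<close>
  have ne: "F \<noteq> {}" using F(3) one_closed by blast
  let ?N = "\<Inter>(N ` F)"
  have "subgroup ?N G"
    by (rule subgroups_Inter) (use NV F(2) ne in auto)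
  moreover have "openin T ?N"
    by (rule openin_Inter) (use NV F(1,2) ne in auto)
  moreover have "\<exists>W\<in>\<U>. ?N #> y \<subseteq> W" if y: "y \<in> carrier G" for y
  proof -
    obtain x where x: "x \<in> F" "y \<in> N x #> x" using F(3) y by blast
    have xc: "x \<in> carrier G" using F(2) x(1) by blast
    have "?N #> y \<subseteq> N x #> y" using x(1) by (auto simp: r_coset_def)
    \<comment> \<open>Since \<open>N x\<close> is a subgroup, its coset is the same through
      \<open>y\<close> as through \<open>x\<close>; no shrinking of neighbourhoods takes
      place.\<close>
    also have "N x #> y = N x #> x"
      using repr_independence[OF x(2) xc] NV[OF xc] by simp
    also have "\<dots> \<subseteq> V x" using NV[OF xc] by simp
    finally show ?thesis using NV[OF xc] by blast
  qed
  ultimately show thesis using that by blast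
qed

text \<open>A cover of K/c pulls back to a cover of K by unions of cosets of \<open>c\<close>, which
  the cosets of some open subgroup \<open>N\<close> refine. The image of \<open>N\<close> in K/c
  then refines the original cover.\<close>

lemma topological_adjoint_entropy_quotient_eq_topological_entropy:
  assumes \<phi>: "\<phi> \<in> hom G G" "continuous_map T T \<phi>"
  defines "c \<equiv> identity_component G T"
  shows "topological_adjoint_entropy (G Mod c) (quotient_group_topology G T c) (induced_endo G c \<phi>) =
    topological_entropy (quotient_group_topology G T c) (induced_endo G c \<phi>)"
proof -
  let ?Q = "quotient_group_topology G T c"
  have c: "subgroup c G" unfolding c_def by (rule subgroup_identity_component)
  have inv: "\<phi> ` c \<subseteq> c" unfolding c_def by (rule identity_component_invariant[OF \<phi>])
  interpret \<pi>: group_hom G "G Mod c" "\<lambda>x. c #> x" by (rule group_hom_coset_map[OF c])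
  interpret Q: compact_semitopological_group "G Mod c" ?Q
    by (rule compact_semitopological_quotient[OF c])
  show ?thesis
  proof (rule Q.topological_adjoint_entropy_eq_topological_entropy)
    show "induced_endo G c \<phi> \<in> hom (G Mod c) (G Mod c)"
      by (rule induced_endo_hom[OF \<phi>(1) c inv])
    show "continuous_map ?Q ?Q (induced_endo G c \<phi>)"
      by (rule induced_endo_continuous[OF \<phi>(1) c inv \<phi>(2)])
    fix \<U> assume U: "open_cover ?Q \<U>"
    let ?\<V> = "(\<lambda>U. {x \<in> topspace T. c #> x \<in> U}) ` \<U>"
    have "\<Union>\<U> = carrier (G Mod c)"
      using U by (simp add: open_cover_def topspace_quotient_group_topology)
    then have "\<Union>?\<V> = topspace T"
      using \<pi>.hom_closed by (auto simp: topspace_eq_carrier)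
    then have "open_cover T ?\<V>"
      using U by (auto simp: open_cover_def openin_quotient_group_topology)
    moreover have "identity_component G T #> x \<subseteq> V" if "V \<in> ?\<V>" "x \<in> V" for V x
    proof -
      obtain U where V: "V = {x \<in> topspace T. c #> x \<in> U}" using \<open>V \<in> ?\<V>\<close> by blast
      then have x: "x \<in> carrier G" "c #> x \<in> U" using \<open>x \<in> V\<close> by (auto simp: topspace_eq_carrier)
      show ?thesis
        using repr_independence[OF _ x(1) c] subgroup.elemrcos_carrier[OF c is_group x(1)] x(2)
        unfolding c_def[symmetric] V by (auto simp: topspace_eq_carrier)
    qed
    ultimately obtain N where N: "subgroup N G" "openin T N"
        "\<forall>x\<in>carrier G. \<exists>V\<in>?\<V>. N #> x \<subseteq> V"
      by (rule saturated_open_cover_refinement)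
    let ?M = "(\<lambda>x. c #> x) ` N"
    have "subgroup ?M (G Mod c)" by (rule \<pi>.subgroup_img_is_subgroup[OF N(1)])
    moreover have "openin ?Q ?M"
      using vimage_coset_map_image[OF c N(1)] identity_component_subset_open_subgroup[OF N(1,2)]
        N(2) subgroup.subset[OF calculation]
      by (simp add: openin_quotient_group_topology topspace_eq_carrier c_def)
    moreover have "\<exists>U\<in>\<U>. C \<subseteq> U" if "C \<in> rcosets\<^bsub>G Mod c\<^esub> ?M" for C
    proof -
      from that obtain x where x: "x \<in> carrier G" "C = ?M #>\<^bsub>G Mod c\<^esub> (c #> x)"
        by (auto simp: RCOSETS_def carrier_FactGroup)
      obtain U where U: "U \<in> \<U>" "\<And>y. y \<in> N #> x \<Longrightarrow> c #> y \<in> U" using bspec[OF N(3) x(1)] by blast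
      have "D \<in> U" if "D \<in> C" for D
      proof -
        \<comment> \<open>A point of the coset of \<open>?M\<close> is the class of some
          \<open>y \<otimes> x\<close> in \<open>N #> x\<close>, which the choice of
          \<open>U\<close> covers.\<close>
        from that obtain y where y: "y \<in> N" "D = (c #> y) \<otimes>\<^bsub>G Mod c\<^esub> (c #> x)"
          unfolding x(2) r_coset_def[of "G Mod c"] by blast
        then have "D = c #> (y \<otimes> x)" using subgroup.mem_carrier[OF N(1)] x(1) by simp
        then show "D \<in> U" using U(2) y(1) by (auto simp: r_coset_def)
      qed
      with U(1) show ?thesis by blast
    qed
    ultimately show "\<exists>N. subgroup N (G Mod c) \<and> openin ?Q N \<and>
        (\<forall>C\<in>rcosets\<^bsub>G Mod c\<^esub> N. \<exists>U\<in>\<U>. C \<subseteq> U)" by blast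
  qed
qed

end

theorem theorem5p3:
  fixes K :: "('a, 'b) monoid_scheme" and \<tau> :: "'a topology" and \<psi> :: "'a \<Rightarrow> 'a"
  assumes "compact_abelian_group K \<tau>"
    and "\<psi> \<in> hom K K"
    and "continuous_map \<tau> \<tau> \<psi>"
  shows "(let c = identity_component K \<tau>;
              \<tau>\<^sub>q = quotient_group_topology K \<tau> c;
              \<psi>\<^sub>q = induced_endo K c \<psi>
          in topological_adjoint_entropy K \<tau> \<psi> = topological_adjoint_entropy (K Mod c) \<tau>\<^sub>q \<psi>\<^sub>q
           \<and> topological_adjoint_entropy (K Mod c) \<tau>\<^sub>q \<psi>\<^sub>q = topological_entropy \<tau>\<^sub>q \<psi>\<^sub>q)
       \<and> (totally_disconnected_space \<tau> \<longrightarrow>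
            topological_adjoint_entropy K \<tau> \<psi> = topological_entropy \<tau> \<psi>)"
proof -
  interpret compact_abelian_group K \<tau> by (rule assms(1))
  interpret S: compact_semitopological_group K \<tau> by (rule compact_semitopological)
  \<comment> \<open>The comparison is applied to K itself instead of being transported along the
    isomorphism with K/c: the identity component is trivial, so every open cover is
    saturated.\<close>
  have "topological_adjoint_entropy K \<tau> \<psi> = topological_entropy \<tau> \<psi>"
    if disc: "totally_disconnected_space \<tau>"
  proof (rule S.topological_adjoint_entropy_eq_topological_entropy[OF assms(2,3)])
    fix \<U> assume U: "open_cover \<tau> \<U>"
    have "identity_component K \<tau> = {\<one>\<^bsub>K\<^esub>}"
      using disc by (simp add: totally_disconnected_space_def identity_component_def topspace_eq_carrier)
    moreover have "V \<subseteq> carrier K" if "V \<in> \<U>" for V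
      using U that openin_subset by (auto simp: open_cover_def topspace_eq_carrier)
    ultimately have "identity_component K \<tau> #>\<^bsub>K\<^esub> x \<subseteq> V" if "V \<in> \<U>" "x \<in> V" for V x
      using that by (fastforce simp: r_coset_def)
    then obtain N where "subgroup N K" "openin \<tau> N"
        "\<forall>x\<in>carrier K. \<exists>V\<in>\<U>. N #>\<^bsub>K\<^esub> x \<subseteq> V"
      by (rule saturated_open_cover_refinement[OF U])
    then show "\<exists>N. subgroup N K \<and> openin \<tau> N \<and> (\<forall>C\<in>rcosets\<^bsub>K\<^esub> N. \<exists>U\<in>\<U>. C \<subseteq> U)"
      by (auto simp: RCOSETS_def)
  qed
  then show ?thesis
    using topological_adjoint_entropy_quotient[OF assms(2,3)]
      topological_adjoint_entropy_quotient_eq_topological_entropy[OF assms(2,3)]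
    by (simp add: Let_def)
qed

end
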